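(* Let $\mathcal{M}=(Q,\Sigma,\cdot,\circ)$ be a reversible invertible Mealy automaton that is not bireversible. Then $\mathrm{Stab}^{+}(v^\omega)\neq\{1\}$ for some nonempty word $v\in\Sigma^*$. Furthermore, the set $\kappa$ of singular points is not empty.
   Context: A Mealy automaton is $\mathcal{M}=(Q,\Sigma,\cdot,\circ)$ with finite nonempty sets $Q$ (states) and $\Sigma$ (alphabet), a transition function $(q,a)\mapsto q\cdot a\in Q$ and a production function $(q,a)\mapsto q\circ a\in\Sigma$; write $q\xrightarrow{a|b}p$ when $q\cdot a=p$, $q\circ a=b$. Extend by $q\circ(a_1\cdots a_n)=(q\circ a_1)\big((q\cdot a_1)\circ(a_2\cdots a_n)\big)$. It is invertible if each map $a\mapsto q\circ a$ is a permutation of $\Sigma$, reversible if each map $q\mapsto q\cdot a$ is a permutation of $Q$, and bireversible if it is invertible, reversible and, for each $b\in\Sigma$, the map sending $q$ to the target of its unique transition with output letter $b$ is a permutation of $Q$. For an invertible automaton each $q$ acts as an automorphism of the rooted tree $\Sigma^*$; $\langle\mathcal{M}\rangle$ is the group generated by these automorphisms (identity $1$), acting on the boundary $\Sigma^\omega$. $\mathrm{Stab}(\xi)=\{g\in\langle\mathcal{M}\rangle:g\circ\xi=\xi\}$, and $\mathrm{Stab}^+(\xi)$ is the set of elements of $\mathrm{Stab}(\xi)$ that are products of (possibly zero) states in $Q$, without inverses. $v^\omega=vvv\cdots$. A point $\xi\in\Sigma^\omega$ is singular if the map $\xi\mapsto\mathrm{Stab}(\xi)$ from $\Sigma^\omega$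 (product topology) to the space of subgroups of $\langle\mathcal{M}\rangle$ (topology induced from the product topology of $\{0,1\}^{\langle\mathcal{M}\rangle}$) is not continuous at $\xi$; $\kappa$ is the set of singular points. *)

theory Defs
  imports
    "HOL-Analysis.Function_Topology"
    "HOL-Algebra.Generated_Groups"
    "HOL-Algebra.Bij"
begin

text \<open>
  The state set and the alphabet are the types \<open>'q\<close> and \<open>'a\<close>; that they are finite (and
  nonempty) is expressed by the sort \<open>finite\<close> in the statements. \<open>trans M q a\<close> is \<open>q \<cdot> a\<close> and
  \<open>out M q a\<close> is the action of \<open>q\<close> on the letter \<open>a\<close>.
\<close>

record ('q, 'a) mealy =
  trans :: "'q \<Rightarrow> 'a \<Rightarrow> 'q"
  out :: "'q \<Rightarrow> 'a \<Rightarrow> 'a"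

definition mealy_invertible :: "('q, 'a) mealy \<Rightarrow> bool" where
  "mealy_invertible M \<longleftrightarrow> (\<forall>q. bij (out M q))"

definition mealy_reversible :: "('q, 'a) mealy \<Rightarrow> bool" where
  "mealy_reversible M \<longleftrightarrow> (\<forall>a. bij (\<lambda>q. trans M q a))"

text \<open>The description below is unique only for invertible \<open>M\<close>.\<close>

definition target_by_output :: "('q, 'a) mealy \<Rightarrow> 'a \<Rightarrow> 'q \<Rightarrow> 'q" where
  "target_by_output M b q = trans M q (THE a. out M q a = b)"

definition mealy_bireversible :: "('q, 'a) mealy \<Rightarrow> bool" where
  "mealy_bireversible M \<longleftrightarrow>
     mealy_invertible M \<and> mealy_reversible M \<and> (\<forall>b. bij (target_by_output M b))"

fun state_act :: "('q, 'a) mealy \<Rightarrow> 'q \<Rightarrow> 'a list \<Rightarrow> 'a list" where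
  "state_act M q [] = []"
| "state_act M q (a # w) = out M q a # state_act M (trans M q a) w"

text \<open>
  The ambient group of all bijections of the set of finite words contains the automorphism
  group of the rooted tree; for invertible \<open>M\<close> the generators are tree automorphisms. The product
  is composition, so the action on words is a left action. (Since \<open>subgroup_generated\<close>
  silently discards generators outside its ambient group, the definition is meant for
  invertible \<open>M\<close> only.)
\<close>

definition automaton_group :: "('q, 'a) mealy \<Rightarrow> ('a list \<Rightarrow> 'a list) monoid" where
  "automaton_group M = subgroup_generated (BijGroup UNIV) (range (state_act M))"

definition positive_elements :: "('q, 'a) mealy \<Rightarrow> ('a list \<Rightarrow> 'a list) set" where
  "positive_elements M =
     {foldr (\<otimes>\<^bsub>automaton_group M\<^esub>) (map (state_act M) qs) \<one>\<^bsub>automaton_group M\<^esub> | qs. True}"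

text \<open>
  Infinite words are functions \<open>nat \<Rightarrow> 'a\<close>. A length- and prefix-preserving \<open>g\<close> acts on them by
  acting on all finite prefixes; see \<open>word_prefix_boundary_act\<close> below.
\<close>

definition word_prefix :: "nat \<Rightarrow> (nat \<Rightarrow> 'a) \<Rightarrow> 'a list" where
  "word_prefix n \<xi> = map \<xi> [0..<n]"

definition boundary_act :: "('a list \<Rightarrow> 'a list) \<Rightarrow> (nat \<Rightarrow> 'a) \<Rightarrow> nat \<Rightarrow> 'a" where
  "boundary_act g \<xi> n = g (word_prefix (Suc n) \<xi>) ! n"

definition omega_power :: "'a list \<Rightarrow> nat \<Rightarrow> 'a" where
  "omega_power v n = v ! (n mod length v)"

definition Stab :: "('q, 'a) mealy \<Rightarrow> (nat \<Rightarrow> 'a) \<Rightarrow> ('a list \<Rightarrow> 'a list) set" where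
  "Stab M \<xi> = {g \<in> carrier (automaton_group M). boundary_act g \<xi> = \<xi>}"

definition Stab_pos :: "('q, 'a) mealy \<Rightarrow> (nat \<Rightarrow> 'a) \<Rightarrow> ('a list \<Rightarrow> 'a list) set" where
  "Stab_pos M \<xi> = Stab M \<xi> \<inter> positive_elements M"

definition boundary_topology :: "(nat \<Rightarrow> 'a) topology" where
  "boundary_topology = product_topology (\<lambda>_. discrete_topology UNIV) UNIV"

text \<open>
  A subgroup is identified with its characteristic function on the carrier, and \<open>bool\<close> plays
  the role of \<open>{0, 1}\<close>.
\<close>

definition subgroup_topology :: "('g, 'm) monoid_scheme \<Rightarrow> 'g set topology" where
  "subgroup_topology G =
     pullback_topology {H. subgroup H G} (\<lambda>H. \<lambda>g\<in>carrier G. g \<in> H)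
       (product_topology (\<lambda>_. discrete_topology (UNIV :: bool set)) (carrier G))"

definition singular_points :: "('q, 'a) mealy \<Rightarrow> (nat \<Rightarrow> 'a) set" where
  "singular_points M =
     {\<xi>. \<not> topcontinuous_at boundary_topology (subgroup_topology (automaton_group M)) (Stab M) \<xi>}"

text \<open>
  The remaining facts show that, for invertible \<open>M\<close>, the above is well behaved: the automaton
  group acts on the boundary, and \<open>Stab M\<close> maps into the space of subgroups, so that
  \<open>topcontinuous_at\<close> cannot fail for lack of a codomain.
\<close>

lemma state_act_length: "length (state_act M q w) = length w"
  by (induction w arbitrary: q) auto

lemma state_act_take: "take n (state_act M q w) = state_act M q (take n w)"
proof (induction w arbitrary: q n)
  case (Cons a w)
  then show ?case by (cases n) auto
qed simp

lemma bij_state_act: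
  assumes "mealy_invertible M"
  shows "bij (state_act M q)"
proof -
  have b: "bij (out M q)" for q using assms by (simp add: mealy_invertible_def)
  have "state_act M q w = state_act M q w' \<Longrightarrow> w = w'" for w w'
  proof (induction w arbitrary: q w')
    case Nil
    then show ?case by (metis length_0_conv state_act_length)
  next
    case (Cons a w)
    then obtain a' u where w': "w' = a' # u" by (cases w') auto
    with Cons.prems have "out M q a = out M q a'" by simp
    with b have "a = a'" by (simp add: bij_is_inj inj_eq)
    with Cons w' show ?case by auto
  qed
  moreover have "\<exists>w. v = state_act M q w" for v
  proof (induction v arbitrary: q)
    case Nil
    show ?case by (rule exI[of _ "[]"]) simp
  next
    case (Cons c v)
    obtain a where "c = out M q a" using bij_is_surj[OF b] by (metis surjE)
    moreover obtain w where "v = state_act M (trans M q a) w" using Cons by blast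
    ultimately show ?case by (intro exI[of _ "a # w"]) simp
  qed
  ultimately show ?thesis by (auto simp: bij_def inj_def surj_def)
qed

lemma group_automaton_group: "group (automaton_group M)"
  unfolding automaton_group_def by (rule group.group_subgroup_generated[OF group_BijGroup])

lemma automaton_group_mult:
  assumes "g \<in> carrier (automaton_group M)" "h \<in> carrier (automaton_group M)"
  shows "g \<otimes>\<^bsub>automaton_group M\<^esub> h = g \<circ> h"
proof -
  have "carrier (automaton_group M) \<subseteq> Bij UNIV"
    unfolding automaton_group_def
    using group.carrier_subgroup_generated_subset[OF group_BijGroup, of UNIV "range (state_act M)"]
    by (simp add: BijGroup_def)
  with assms show ?thesis
    by (auto simp: automaton_group_def subgroup_generated_def BijGroup_def compose_def)
qed

lemma automaton_group_one: "\<one>\<^bsub>automaton_group M\<^esub> = id"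
  by (auto simp: automaton_group_def subgroup_generated_def BijGroup_def)

lemma state_act_in_automaton_group:
  assumes "mealy_invertible M"
  shows "state_act M q \<in> carrier (automaton_group M)"
proof -
  have "state_act M q \<in> carrier (BijGroup UNIV)"
    using bij_state_act[OF assms] by (simp add: BijGroup_def Bij_def)
  then show ?thesis
    by (auto simp: automaton_group_def subgroup_generated_def intro: generate.incl)
qed

lemma automaton_group_tree:
  assumes "g \<in> carrier (automaton_group M)"
  shows "length (g w) = length w \<and> take n (g w) = g (take n w)"
proof -
  have "g \<in> generate (BijGroup UNIV) (carrier (BijGroup UNIV) \<inter> range (state_act M))"
    using assms by (simp add: automaton_group_def subgroup_generated_def)
  then show ?thesis
  proof (induction arbitrary: w n)
    case one
    then show ?case by (simp add: BijGroup_def)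
  next
    case (incl h)
    then show ?case by (auto simp: state_act_length state_act_take)
  next
    case (inv h)
    then obtain q where q: "h = state_act M q" and h: "h \<in> Bij UNIV"
      by (auto simp: BijGroup_def)
    have bij: "bij h" using h by (simp add: Bij_def)
    have i: "inv\<^bsub>BijGroup UNIV\<^esub> h = inv_into UNIV h"
      by (rule ext) (simp add: inv_BijGroup[OF h])
    obtain u where u: "w = h u" using bij by (metis bij_pointE)
    have [simp]: "inv_into UNIV h (h x) = x" for x using bij by (simp add: bij_is_inj)
    have "take n (h u) = h (take n u)" "length (h u) = length u"
      by (simp_all add: q state_act_take state_act_length)
    then show ?case by (simp add: i u)
  next
    case (eng h1 h2)
    have "h1 \<in> carrier (BijGroup UNIV)" "h2 \<in> carrier (BijGroup UNIV)"
      using eng.hyps group.generate_in_carrier[OF group_BijGroup] by blast+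
    then have "h1 \<otimes>\<^bsub>BijGroup UNIV\<^esub> h2 = h1 \<circ> h2"
      by (auto simp: BijGroup_def compose_def)
    with eng.IH show ?case by simp
  qed
qed

lemma word_prefix_boundary_act:
  assumes g: "g \<in> carrier (automaton_group M)"
  shows "word_prefix n (boundary_act g \<xi>) = g (word_prefix n \<xi>)"
proof (rule nth_equalityI)
  show "length (word_prefix n (boundary_act g \<xi>)) = length (g (word_prefix n \<xi>))"
    using automaton_group_tree[OF g] by (simp add: word_prefix_def)
next
  fix i assume "i < length (word_prefix n (boundary_act g \<xi>))"
  then have i: "i < n" by (simp add: word_prefix_def)
  have "word_prefix (Suc i) \<xi> = take (Suc i) (word_prefix n \<xi>)"
    using i by (simp add: word_prefix_def take_map del: upt_Suc)
  then have "g (word_prefix (Suc i) \<xi>) = take (Suc i) (g (word_prefix n \<xi>))"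
    using automaton_group_tree[OF g] by metis
  then show "word_prefix n (boundary_act g \<xi>) ! i = g (word_prefix n \<xi>) ! i"
    using i by (simp add: boundary_act_def word_prefix_def)
qed

lemma boundary_act_comp:
  assumes "g \<in> carrier (automaton_group M)" "h \<in> carrier (automaton_group M)"
  shows "boundary_act (g \<circ> h) \<xi> = boundary_act g (boundary_act h \<xi>)"
  by (rule ext) (simp add: boundary_act_def[of g] boundary_act_def[of "g \<circ> h"]
      word_prefix_boundary_act[OF assms(2)])

lemma boundary_act_id: "boundary_act id \<xi> = \<xi>"
  by (rule ext) (simp add: boundary_act_def word_prefix_def nth_append)

lemma subgroup_Stab: "subgroup (Stab M \<xi>) (automaton_group M)"
proof -
  interpret G: group "automaton_group M" by (rule group_automaton_group)
  show ?thesis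
  proof (rule G.subgroupI)
    show "Stab M \<xi> \<noteq> {}"
      using G.one_closed by (auto simp: Stab_def automaton_group_one boundary_act_id)
  next
    fix g assume g: "g \<in> Stab M \<xi>"
    then have gc: "g \<in> carrier (automaton_group M)" and fx: "boundary_act g \<xi> = \<xi>"
      by (auto simp: Stab_def)
    have "inv\<^bsub>automaton_group M\<^esub> g \<circ> g = id"
      using G.l_inv[OF gc] gc by (simp add: automaton_group_mult automaton_group_one)
    then have "boundary_act (inv\<^bsub>automaton_group M\<^esub> g) \<xi> = \<xi>"
      using boundary_act_comp[OF G.inv_closed[OF gc] gc, of \<xi>] fx by (simp add: boundary_act_id)
    then show "inv\<^bsub>automaton_group M\<^esub> g \<in> Stab M \<xi>" using gc by (simp add: Stab_def)
  next
    fix g h assume "g \<in> Stab M \<xi>" "h \<in> Stab M \<xi>"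
    then show "g \<otimes>\<^bsub>automaton_group M\<^esub> h \<in> Stab M \<xi>"
      using boundary_act_comp[of g M h \<xi>] G.m_closed[of g h]
      by (auto simp: Stab_def automaton_group_mult)
  qed (auto simp: Stab_def)
qed

lemma topspace_boundary_topology: "topspace boundary_topology = UNIV"
  by (simp add: boundary_topology_def)

lemma topspace_subgroup_topology: "topspace (subgroup_topology G) = {H. subgroup H G}"
  by (auto simp: subgroup_topology_def topspace_pullback_topology)

end

theory Submission
  imports Defs
begin

text \<open>
  Two independent observations combine.

  The map \<open>(q, a) \<mapsto> (q \<cdot> a, q \<circ> a)\<close> on the finite set of pairs has a periodic orbit
  \<open>(q\<^sub>t, a\<^sub>t)\<close>, say of period \<open>N\<close>. Along it \<open>q\<^sub>t\<close> turns \<open>a\<^sub>t a\<^sub>t\<^sub>+\<^sub>1 \<dots>\<close> into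
  \<open>a\<^sub>t\<^sub>+\<^sub>1 a\<^sub>t\<^sub>+\<^sub>2 \<dots>\<close>: reading the letter \<open>a\<^sub>t\<close>, it outputs the next letter and moves to the next
  state. So \<open>q\<^sub>0\<close>, \<open>q\<^sub>1\<close>, \<open>\<dots>\<close> applied in succession shift the word one letter at a time, and the product
  \<open>g = q\<^sub>N\<^sub>-\<^sub>1 \<cdots> q\<^sub>0\<close> fixes \<open>\<xi> = a\<^sub>0 a\<^sub>1 a\<^sub>2 \<dots>\<close>, which is \<open>v\<^sup>\<omega>\<close> for \<open>v = a\<^sub>0 \<dots> a\<^sub>N\<^sub>-\<^sub>1\<close>
  (\<open>state_act_diag_word\<close>). In the language of Wang tiles this is a tiling that is constant along
  antidiagonals.

  Failure of bireversibility gives a letter \<open>b\<close> and a state \<open>r\<close> that no transition with output \<open>b\<close>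
  enters. Suppose that a word of states starting (on the output side) with a state from which \<open>r\<close> can
  be reached acts trivially. Restrictions of the identity are the identity, so some word starting
  with \<open>r\<close> acts trivially as well. By reversibility and finiteness the transition by \<open>b\<close> permutes
  the trivial words of a given length, so this word is entered, through input \<open>b\<close>, from
  another trivial word; as that one also outputs \<open>b\<close>, its first state enters \<open>r\<close> with output \<open>b\<close>,
  a contradiction (\<open>word_to_missing_target_nontrivial\<close>).

  By reversibility, the states from which \<open>r\<close> can be reached are closed under transitions, so the
  periodic orbit can be taken among them. Then \<open>g\<close> is not the identity. Its restriction after \<open>n\<close>
  letters of \<open>\<xi>\<close> is the same product started at \<open>q\<^sub>n\<close>, which is not the identity either; hence \<open>g\<close>
  fixes \<open>\<xi>\<close> but moves points arbitrarily close to \<open>\<xi>\<close>, and \<open>\<xi>\<close> is singular.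
\<close>

section \<open>Runs and restrictions\<close>

definition run :: "('q, 'a) mealy \<Rightarrow> 'q \<Rightarrow> 'a list \<Rightarrow> 'q" where
  "run M = foldl (trans M)"

lemma run_simps [simp]:
  "run M q [] = q"
  "run M q (a # w) = run M (trans M q a) w"
  by (simp_all add: run_def)

lemma state_act_append:
  "state_act M q (u @ w) = state_act M q u @ state_act M (run M q u) w"
  by (induction u arbitrary: q) simp_all

lemma out_trivial_state: "state_act M q = id \<Longrightarrow> out M q a = a"
  by (drule fun_cong[of _ _ "[a]"]) simp

lemma trans_trivial_state:
  assumes "state_act M q = id"
  shows "state_act M (trans M q a) = id"
proof (rule ext)
  fix w
  show "state_act M (trans M q a) w = id w"
    using fun_cong[OF assms, of "a # w"] by simp
qed

lemma run_trivial_state: "state_act M q = id \<Longrightarrow> state_act M (run M q u) = id"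
  by (induction u arbitrary: q) (simp_all add: trans_trivial_state)

text \<open>
  In a reversible automaton reachability is symmetric. Here: the set \<open>C\<close> of states that cannot
  reach \<open>r\<close> is mapped into itself by the letter \<open>a\<close>, hence onto itself since it is finite, and by
  injectivity nothing outside \<open>C\<close> is mapped into \<open>C\<close>.
\<close>

lemma reversible_preserves_reachability:
  fixes M :: "('q::finite, 'a) mealy"
  assumes rev: "mealy_reversible M" and q: "\<exists>u. run M q u = r"
  shows "\<exists>u. run M (trans M q a) u = r"
proof (rule ccontr)
  define C where "C = {p. \<nexists>u. run M p u = r}"
  let ?f = "\<lambda>p. trans M p a"
  have inj: "inj ?f" using rev by (simp add: mealy_reversible_def bij_is_inj)
  have "run M p (a # u) = run M (?f p) u" for p u by simp
  then have "?f ` C \<subseteq> C" unfolding C_def by blast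
  then have "?f ` C = C"
    using inj by (intro endo_inj_surj) (auto intro: inj_on_subset)
  moreover assume "\<nexists>u. run M (trans M q a) u = r"
  ultimately have "?f q \<in> ?f ` C" by (simp add: C_def)
  then have "q \<in> C" using inj by (auto dest: injD)
  with q show False by (simp add: C_def)
qed

section \<open>The automaton of state words\<close>

text \<open>
  The leftmost state of a word acts last, as in a product of maps.
\<close>

primrec word_out :: "('q, 'a) mealy \<Rightarrow> 'q list \<Rightarrow> 'a \<Rightarrow> 'a" where
  "word_out M [] a = a"
| "word_out M (q # qs) a = out M q (word_out M qs a)"

primrec word_trans :: "('q, 'a) mealy \<Rightarrow> 'q list \<Rightarrow> 'a \<Rightarrow> 'q list" where
  "word_trans M [] a = []"
| "word_trans M (q # qs) a = trans M q (word_out M qs a) # word_trans M qs a"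

text \<open>
  The disjoint union of all powers of \<open>M\<close>. Treating words as states of one automaton makes the notions
  for single states (action, run, restriction) available for positive products; only its state set
  is infinite, but transitions preserve the length of words.
\<close>

definition word_automaton :: "('q, 'a) mealy \<Rightarrow> ('q list, 'a) mealy" where
  "word_automaton M = \<lparr>trans = word_trans M, out = word_out M\<rparr>"

lemma word_automaton_simps [simp]:
  "trans (word_automaton M) = word_trans M"
  "out (word_automaton M) = word_out M"
  by (simp_all add: word_automaton_def)

lemma length_word_trans [simp]: "length (word_trans M qs a) = length qs"
  by (induction qs) simp_all

lemma state_act_word_Nil: "state_act (word_automaton M) [] = id"
proof
  fix w show "state_act (word_automaton M) [] w = id w" by (induction w) simp_all
qed

lemma state_act_word_Cons:
  "state_act (word_automaton M) (q # qs) = state_act M q \<circ> state_act (word_automaton M) qs"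
proof
  fix w
  show "state_act (word_automaton M) (q # qs) w
      = (state_act M q \<circ> state_act (word_automaton M) qs) w"
    by (induction w arbitrary: q qs) simp_all
qed

lemma run_word_Cons:
  "run (word_automaton M) (q # qs) u
   = run M q (state_act (word_automaton M) qs u) # run (word_automaton M) qs u"
  by (induction u arbitrary: q qs) simp_all

lemma bij_state_act_word:
  assumes "mealy_invertible M"
  shows "bij (state_act (word_automaton M) qs)"
proof (induction qs)
  case Nil
  show ?case unfolding state_act_word_Nil by (rule bij_id)
next
  case (Cons q qs)
  then show ?case
    unfolding state_act_word_Cons by (rule bij_comp) (rule bij_state_act[OF assms])
qed

text \<open>
  The powers of a reversible automaton are reversible: the right part of a word is determined
  first, hence so is the letter that reaches the leftmost state.
\<close>

lemma inj_word_trans: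
  assumes "mealy_reversible M"
  shows "inj (\<lambda>qs. word_trans M qs a)"
proof (rule injI)
  have inj: "inj (\<lambda>q. trans M q c)" for c
    using assms by (simp add: mealy_reversible_def bij_is_inj)
  fix qs ps
  show "word_trans M qs a = word_trans M ps a \<Longrightarrow> qs = ps"
  proof (induction qs arbitrary: ps)
    case Nil
    then show ?case by (cases ps) simp_all
  next
    case (Cons q qs)
    then show ?case using inj by (cases ps) (auto dest: injD)
  qed
qed

text \<open>
  The trivial words of a given length form a finite set that is stable under the injective
  transition by \<open>b\<close>, which therefore permutes them.
\<close>

lemma trivial_word_predecessor:
  fixes M :: "('q::finite, 'a) mealy"
  assumes "mealy_reversible M" and "state_act (word_automaton M) qs = id"
  obtains ps where "word_trans M ps b = qs" and "state_act (word_automaton M) ps = id"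
proof -
  define S where "S = {ps. length ps = length qs \<and> state_act (word_automaton M) ps = id}"
  have "finite {ps :: 'q list. set ps \<subseteq> UNIV \<and> length ps = length qs}"
    by (rule finite_lists_length_eq) simp
  then have "finite S" by (rule rev_finite_subset) (auto simp: S_def)
  moreover have "(\<lambda>ps. word_trans M ps b) ` S \<subseteq> S"
    using trans_trivial_state[of "word_automaton M" _ b] by (auto simp: S_def)
  moreover have "inj_on (\<lambda>ps. word_trans M ps b) S"
    using inj_word_trans[OF assms(1)] by (rule inj_on_subset) simp
  ultimately have "(\<lambda>ps. word_trans M ps b) ` S = S" by (rule endo_inj_surj)
  moreover have "qs \<in> S" using assms(2) by (simp add: S_def)
  ultimately obtain ps where "ps \<in> S" "word_trans M ps b = qs" by (metis imageE)
  then show ?thesis using that by (simp add: S_def)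
qed

section \<open>Non-trivial positive elements\<close>

text \<open>
  A reversible invertible automaton fails to be bireversible because some map
  \<open>target_by_output M b\<close> is not a bijection, and on a finite set of states it then is not onto.
\<close>

lemma not_bireversible_missing_target:
  fixes M :: "('q::finite, 'a) mealy"
  assumes "mealy_reversible M" and inv: "mealy_invertible M" and "\<not> mealy_bireversible M"
  shows "\<exists>b r. \<forall>q a. trans M q a = r \<longrightarrow> out M q a \<noteq> b"
proof -
  obtain b where "\<not> bij (target_by_output M b)"
    using assms by (auto simp: mealy_bireversible_def)
  then have "\<not> surj (target_by_output M b)"
    using finite_UNIV_surj_inj[of "target_by_output M b"] by (auto simp: bij_def)
  then obtain r where r: "r \<notin> range (target_by_output M b)" by blast
  have "out M q a \<noteq> b" if "trans M q a = r" for q a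
  proof
    assume b: "out M q a = b"
    have "inj (out M q)" using inv by (simp add: mealy_invertible_def bij_is_inj)
    with b have "(THE c. out M q c = b) = a" by (intro the_equality) (auto dest: injD)
    with that r show False by (auto simp: target_by_output_def)
  qed
  then show ?thesis by blast
qed

text \<open>
  Non-triviality is proved by moving backwards: a trivial word starting with \<open>r\<close> would have a
  trivial predecessor under the letter \<open>b\<close>, whose leftmost state must output \<open>b\<close> on its way to \<open>r\<close>.
\<close>

lemma word_to_missing_target_nontrivial:
  fixes M :: "('q::finite, 'a) mealy"
  assumes rev: "mealy_reversible M" and inv: "mealy_invertible M"
    and missing: "\<And>p a. trans M p a = r \<Longrightarrow> out M p a \<noteq> b"
    and q: "\<exists>u. run M q u = r"
  shows "state_act (word_automaton M) (q # qs) \<noteq> id"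
proof
  assume triv: "state_act (word_automaton M) (q # qs) = id"
  obtain u where u: "run M q u = r" using q by blast
  \<comment> \<open>For the state \<open>q\<close> to read \<open>u\<close>, the whole word has to read the preimage of \<open>u\<close> under \<open>qs\<close>.\<close>
  obtain u' where u': "u = state_act (word_automaton M) qs u'"
    using bij_is_surj[OF bij_state_act_word[OF inv]] by (metis surjE)
  have "state_act (word_automaton M) (r # run (word_automaton M) qs u') = id"
    using run_trivial_state[OF triv, of u'] u u' by (simp add: run_word_Cons)
  then obtain ps where ps: "word_trans M ps b = r # run (word_automaton M) qs u'"
    and ps_triv: "state_act (word_automaton M) ps = id"
    using trivial_word_predecessor[OF rev] by metis
  obtain p ps' where "ps = p # ps'" using ps by (cases ps) auto
  with ps have "trans M p (word_out M ps' b) = r" by simp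
  moreover have "out M p (word_out M ps' b) = b"
    using out_trivial_state[OF ps_triv, of b] \<open>ps = p # ps'\<close> by simp
  ultimately show False using missing by blast
qed

section \<open>Diagonal orbits\<close>

text \<open>
  An orbit of \<open>(q, a) \<mapsto> (q \<cdot> a, q \<circ> a)\<close>. Placing the transition of \<open>q (i + j)\<close> on \<open>a (i + j)\<close> in
  column \<open>i\<close> and row \<open>j\<close> gives a consistent tiling of a quadrant: the row at height \<open>j\<close> reads
  \<open>a j, a (j + 1), \<dots>\<close> and writes the same sequence shifted by one.
\<close>

locale diagonal_orbit =
  fixes M :: "('q, 'a) mealy" and q :: "nat \<Rightarrow> 'q" and a :: "nat \<Rightarrow> 'a"
  assumes trans_q: "trans M (q t) (a t) = q (Suc t)"
    and out_q: "out M (q t) (a t) = a (Suc t)"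
begin

text \<open>
  The product of the \<open>k\<close> states beginning with \<open>q i\<close>, in the order that lets \<open>q i\<close> act first;
  it shifts the sequence \<open>a i, a (i + 1), \<dots>\<close> by \<open>k\<close>.
\<close>

definition diag_word :: "nat \<Rightarrow> nat \<Rightarrow> 'q list" where
  "diag_word k i = rev (map q [i..<i + k])"

lemma diag_word_step:
  "word_out M (diag_word k i) (a i) = a (i + k)"
  "word_trans M (diag_word k i) (a i) = diag_word k (Suc i)"
  by (induction k) (simp_all add: diag_word_def trans_q out_q)

lemma state_act_diag_word:
  "state_act (word_automaton M) (diag_word k i) (map a [i..<i + n]) = map a [i + k..<i + k + n]"
proof (induction n arbitrary: i)
  case (Suc n)
  from Suc[of "Suc i"] show ?case
    by (simp add: upt_rec[of i] upt_rec[of "i + k"] diag_word_step del: upt_Suc)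
qed simp

lemma run_diag_word:
  "run (word_automaton M) (diag_word k i) (map a [i..<i + n]) = diag_word k (i + n)"
proof (induction n arbitrary: i)
  case (Suc n)
  from Suc[of "Suc i"] show ?case
    by (simp add: upt_rec[of i] diag_word_step del: upt_Suc)
qed simp

end

text \<open>
  The orbit of any starting pair is eventually periodic, and dropping the preperiod \<open>i\<close> makes it
  periodic. The set \<open>B\<close> keeps the states inside a prescribed part of the automaton.
\<close>

lemma periodic_diagonal_orbit:
  fixes M :: "('q::finite, 'a::finite) mealy"
  assumes "r \<in> B" and closed: "\<And>p c. p \<in> B \<Longrightarrow> trans M p c \<in> B"
  obtains q a N where "diagonal_orbit M q a" "N > 0" "\<And>t. a (t + N) = a t" "\<And>t. q t \<in> B"
proof -
  define \<phi> where "\<phi> = (\<lambda>(p, c). (trans M p c, out M p c))"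
  define x where "x t = (\<phi> ^^ t) (r, undefined)" for t
  have x_Suc: "x (Suc t) = \<phi> (x t)" for t by (simp add: x_def)
  have x_add: "x (t + s) = (\<phi> ^^ t) (x s)" for t s by (simp add: x_def funpow_add)
  have B: "fst (x t) \<in> B" for t
  proof (induction t)
    case 0
    show ?case using assms(1) by (simp add: x_def)
  next
    case (Suc t)
    then show ?case by (simp add: x_Suc \<phi>_def case_prod_beta closed)
  qed
  have "\<not> inj x" using finite_imageD[of x UNIV] by auto
  then obtain i j where ij: "i < j" "x i = x j"
    by (metis injI linorder_neqE_nat)
  have per: "x (t + (j - i) + i) = x (t + i)" for t
    using ij x_add[of t j] x_add[of t i] by simp
  have "diagonal_orbit M (\<lambda>t. fst (x (t + i))) (\<lambda>t. snd (x (t + i)))"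
    by unfold_locales (simp_all add: x_Suc \<phi>_def case_prod_beta)
  then show ?thesis
  proof (rule that)
    show "0 < j - i" using ij by simp
    show "snd (x (t + (j - i) + i)) = snd (x (t + i))" for t by (simp only: per)
    show "fst (x (t + i)) \<in> B" for t by (rule B)
  qed
qed

section \<open>Positive elements and singular points\<close>

lemma foldr_mult_state_acts:
  assumes "mealy_invertible M"
  shows "foldr (\<otimes>\<^bsub>automaton_group M\<^esub>) (map (state_act M) qs) \<one>\<^bsub>automaton_group M\<^esub>
      = state_act (word_automaton M) qs \<and>
    state_act (word_automaton M) qs \<in> carrier (automaton_group M)"
proof -
  interpret G: group "automaton_group M" by (rule group_automaton_group)
  show ?thesis
  proof (induction qs)
    case Nil
    then show ?case
      using G.one_closed by (simp add: automaton_group_one state_act_word_Nil id_def)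
  next
    case (Cons q qs)
    note q = state_act_in_automaton_group[OF assms, of q]
    from Cons G.m_closed[OF q] show ?case
      by (simp add: state_act_word_Cons automaton_group_mult[OF q] comp_def)
  qed
qed

text \<open>
  The subgroups that contain \<open>g\<close> form an open set. If \<open>Stab\<close> were continuous at \<open>\<xi>\<close>, then \<open>g\<close>
  would fix every point of some cylinder around \<open>\<xi>\<close>.
\<close>

lemma singular_pointI:
  fixes M :: "('q, 'a) mealy"
  assumes g: "g \<in> Stab M \<xi>"
    and moved: "\<And>n. \<exists>\<eta>. word_prefix n \<eta> = word_prefix n \<xi> \<and> boundary_act g \<eta> \<noteq> \<eta>"
  shows "\<xi> \<in> singular_points M"
proof -
  let ?G = "automaton_group M"
  let ?P = "product_topology (\<lambda>_. discrete_topology (UNIV :: bool set)) (carrier ?G)"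
  have gc: "g \<in> carrier ?G" using g by (simp add: Stab_def)
  define U where "U = {H. subgroup H ?G \<and> g \<in> H}"
  have "openin ?P {f \<in> topspace ?P. f g \<in> {True}}"
    by (rule openin_continuous_map_preimage[OF continuous_map_product_projection[OF gc]]) simp
  then have U: "openin (subgroup_topology ?G) U"
    unfolding subgroup_topology_def openin_pullback_topology
    by (intro exI[of _ "{f \<in> topspace ?P. f g \<in> {True}}"]) (auto simp: U_def gc PiE_def)
  have "\<not> topcontinuous_at boundary_topology (subgroup_topology ?G) (Stab M) \<xi>"
  proof
    assume "topcontinuous_at boundary_topology (subgroup_topology ?G) (Stab M) \<xi>"
    moreover have "Stab M \<xi> \<in> U" using g subgroup_Stab by (auto simp: U_def)
    ultimately obtain V where V: "openin boundary_topology V" "\<xi> \<in> V"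
      and fixed: "\<And>\<eta>. \<eta> \<in> V \<Longrightarrow> g \<in> Stab M \<eta>"
      using U unfolding topcontinuous_at_def by (auto simp: U_def)
    obtain X where X: "finite {i. X i \<noteq> (UNIV :: 'a set)}" "\<xi> \<in> Pi\<^sub>E UNIV X" "Pi\<^sub>E UNIV X \<subseteq> V"
      using product_topology_open_contains_basis[OF V[unfolded boundary_topology_def]] by auto
    obtain n where n: "\<And>i. X i \<noteq> UNIV \<Longrightarrow> i < n"
      using finite_nat_set_iff_bounded[THEN iffD1, OF X(1)] by auto
    obtain \<eta> where \<eta>: "word_prefix n \<eta> = word_prefix n \<xi>" "boundary_act g \<eta> \<noteq> \<eta>"
      using moved by blast
    have "\<eta> i = \<xi> i" if "i < n" for i
      using arg_cong[OF \<eta>(1), of "\<lambda>w. w ! i"] that by (simp add: word_prefix_def)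
    then have "\<eta> \<in> Pi\<^sub>E UNIV X" using n X(2) by (auto simp: PiE_iff) (metis UNIV_I)
    then show False using fixed X(3) \<eta>(2) by (auto simp: Stab_def)
  qed
  then show ?thesis by (simp add: singular_points_def)
qed

lemma restriction_moves_point:
  assumes g: "state_act (word_automaton M) qs \<in> carrier (automaton_group M)"
    and r: "state_act (word_automaton M) (run (word_automaton M) qs (word_prefix n \<xi>)) \<noteq> id"
  shows "\<exists>\<eta>. word_prefix n \<eta> = word_prefix n \<xi> \<and>
    boundary_act (state_act (word_automaton M) qs) \<eta> \<noteq> \<eta>"
proof -
  let ?A = "word_automaton M" and ?p = "word_prefix n \<xi>"
  obtain u where u: "state_act ?A (run ?A qs ?p) u \<noteq> u"
    using r by (auto simp: fun_eq_iff)
  \<comment> \<open>Beyond the prefix and \<open>u\<close> the letters are arbitrary; the list access just supplies some.\<close>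
  define \<eta> where "\<eta> i = (if i < n then \<xi> i else u ! (i - n))" for i
  have pre: "word_prefix n \<eta> = ?p" by (simp add: word_prefix_def \<eta>_def)
  have "word_prefix (n + length u) \<eta> = ?p @ u"
    by (rule nth_equalityI) (auto simp: word_prefix_def \<eta>_def nth_append)
  moreover have "state_act ?A qs (?p @ u) \<noteq> ?p @ u"
    using u by (simp add: state_act_append state_act_length)
  ultimately have "boundary_act (state_act ?A qs) \<eta> \<noteq> \<eta>"
    using word_prefix_boundary_act[OF g, of "n + length u" \<eta>] by metis
  with pre show ?thesis by blast
qed

theorem proposition5p14:
  fixes M :: "('q::finite, 'a::finite) mealy"
  assumes "mealy_reversible M"
    and "mealy_invertible M"
    and "\<not> mealy_bireversible M"
  shows "(\<exists>v::'a list. v \<noteq> [] \<and> Stab_pos M (omega_power v) \<noteq> {\<one>\<^bsub>automaton_group M\<^esub>})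
    \<and> singular_points M \<noteq> {}"
proof -
  let ?A = "word_automaton M"
  obtain b r where missing: "\<And>p c. trans M p c = r \<Longrightarrow> out M p c \<noteq> b"
    using not_bireversible_missing_target[OF assms] by metis
  define B where "B = {p. \<exists>u. run M p u = r}"
  have "run M r [] = r" by simp
  then have rB: "r \<in> B" unfolding B_def by blast
  have closed: "trans M p c \<in> B" if "p \<in> B" for p c
    using that reversible_preserves_reachability[OF assms(1)] by (simp add: B_def)
  obtain q a N where "diagonal_orbit M q a" and N: "N > 0"
    and per: "\<And>t. a (t + N) = a t" and qB: "\<And>t. q t \<in> B"
    using periodic_diagonal_orbit[OF rB closed] by blast
  interpret diagonal_orbit M q a by fact
  have nontriv: "state_act ?A (diag_word N n) \<noteq> id" for n
  proof -
    have "diag_word N n = q (n + N - 1) # diag_word (N - 1) n"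
      using N by (cases N) (simp_all add: diag_word_def)
    then show ?thesis
      using word_to_missing_target_nontrivial[OF assms(1,2) missing] qB by (simp add: B_def)
  qed
  define g where "g = state_act ?A (diag_word N 0)"
  have g: "g \<in> carrier (automaton_group M)" "g \<in> positive_elements M"
    using foldr_mult_state_acts[OF assms(2), of "diag_word N 0"]
    unfolding g_def positive_elements_def by (simp, metis (mono_tags, lifting) mem_Collect_eq)
  have "boundary_act g a = a"
  proof
    fix n
    show "boundary_act g a n = a n"
      using state_act_diag_word[of N 0 "Suc n"] per[of n]
      by (simp add: boundary_act_def g_def word_prefix_def add.commute del: upt_Suc)
  qed
  then have stab: "g \<in> Stab M a" using g(1) by (simp add: Stab_def)
  define v where "v = map a [0..<N]"
  have "a (s + k * N) = a s" for s k
  proof (induction k)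
    case (Suc k)
    then show ?case using per[of "s + k * N"] by (simp add: ac_simps)
  qed simp
  then have "a n = a (n mod N)" for n
    using mod_mult_div_eq[of n N] by (metis mult.commute)
  then have "omega_power v = a"
    using N by (intro ext) (simp add: omega_power_def v_def)
  moreover have "g \<noteq> id" unfolding g_def by (rule nontriv)
  ultimately have "Stab_pos M (omega_power v) \<noteq> {\<one>\<^bsub>automaton_group M\<^esub>}"
    using stab g(2) by (auto simp: Stab_pos_def automaton_group_one)
  moreover have "v \<noteq> []" using N by (simp add: v_def)
  moreover have "a \<in> singular_points M"
  proof (rule singular_pointI[OF stab])
    fix n
    have "run ?A (diag_word N 0) (word_prefix n a) = diag_word N n"
      using run_diag_word[of N 0 n] by (simp add: word_prefix_def)
    then show "\<exists>\<eta>. word_prefix n \<eta> = word_prefix n a \<and> boundary_act g \<eta> \<noteq> \<eta>"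
      using restriction_moves_point[of M "diag_word N 0" n a] g(1) nontriv
      by (simp add: g_def)
  qed
  ultimately show ?thesis by blast
qed

end
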